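(* For complex-valued $v_1,v_2\in L_2(-\infty,+\infty)$ and $\alpha\in\mathbb{R}$, let $A(v_1,v_2,\alpha)$ be the operator in $L_2(-\infty,+\infty)$ acting by $$A(v_1,v_2,\alpha)\psi(x)=i\psi'(x)+v_1(x)\Big[\psi(-0)+\tfrac{i}{2}\langle\psi,v_1\rangle\Big]+v_2(x)\Big[\psi(+0)-\tfrac{i}{2}\langle\psi,v_2\rangle\Big],\quad x\neq0,$$ on the domain $\{\psi\in W_2^1(\Omega):\ \psi(+0)-i\langle\psi,v_2\rangle=e^{i\alpha}[\psi(-0)+i\langle\psi,v_1\rangle]\}$. Then the operators $A(v_1,v_2,\alpha)$ and $A(\hat v_1,\hat v_2,\alpha)$ (with $\hat v_1,\hat v_2\in L_2$) have the same domain if and only if $$v_1+e^{i\alpha}v_2=\hat v_1+e^{i\alpha}\hat v_2.$$ Setting $v=v_1+e^{i\alpha}v_2$, the operators $A(v_1,v_2,\alpha)$ and $A(v,0,\alpha)$ have the same domain, and their difference $$\big(A(v_1,v_2,\alpha)-A(v,0,\alpha)\big)\psi=\tfrac{i}{2}e^{i\alpha}v_2\langle\psi,v_1\rangle-\tfrac{i}{2}e^{-i\alpha}v_1\langle\psi,v_2\rangle$$ is an integral operator of rank at most $2$. Under the condition $v_1+e^{i\alpha}v_2=\hat v_1+e^{i\alpha}\hat v_2$, the difference $A(v_1,v_2,\alpha)-A(\hat v_1,\hat v_2,\alpha)$ is an integral operator of rank at most $4$. These integral operators are bounded and symmetric.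
   Context: $\Omega=\mathbb{R}\setminus\{0\}$; $W_2^1(\Omega)$ consists of functions whose restrictions to each half-line $(-\infty,0)$, $(0,\infty)$ belong to $W_2^1$ of that half-line; $\psi(\pm0)$ are one-sided limits at $0$; $\langle f,g\rangle=\int f\bar g\,dx$. *)

theory Defs
  imports "HOL-Analysis.Analysis"
begin

definition L2 :: "(real \<Rightarrow> complex) set" where
  "L2 = {f. f \<in> borel_measurable lborel \<and> integrable lborel (\<lambda>x. (cmod (f x))^2)}"

definition inner_L2 :: "(real \<Rightarrow> complex) \<Rightarrow> (real \<Rightarrow> complex) \<Rightarrow> complex" where
  "inner_L2 f g = (LINT x|lborel. f x * cnj (g x))"

text \<open>Sobolev space on Omega = R minus 0: the function is in L2 and is absolutely continuous
  on each half-line with an L2 derivative g (the representative chosen is the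
  continuous one on each half-line; its value at 0 is irrelevant).\<close>
definition W21_Omega :: "(real \<Rightarrow> complex) set" where
  "W21_Omega = {\<psi>. \<psi> \<in> L2 \<and>
     (\<exists>g\<in>L2. (\<forall>x y. 0 < x \<longrightarrow> x \<le> y \<longrightarrow> \<psi> y - \<psi> x = integral {x..y} g) \<and>
              (\<forall>x y. x \<le> y \<longrightarrow> y < 0 \<longrightarrow> \<psi> y - \<psi> x = integral {x..y} g))}"

definition lim_minus0 :: "(real \<Rightarrow> complex) \<Rightarrow> complex" where
  "lim_minus0 \<psi> = Lim (at_left 0) \<psi>"

definition lim_plus0 :: "(real \<Rightarrow> complex) \<Rightarrow> complex" where
  "lim_plus0 \<psi> = Lim (at_right 0) \<psi>"

definition domA :: "(real \<Rightarrow> complex) \<Rightarrow> (real \<Rightarrow> complex) \<Rightarrow> real \<Rightarrow> (real \<Rightarrow> complex) set" where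
  "domA v1 v2 \<alpha> = {\<psi>. \<psi> \<in> W21_Omega \<and>
     lim_plus0 \<psi> - \<i> * inner_L2 \<psi> v2 = exp (\<i> * of_real \<alpha>) * (lim_minus0 \<psi> + \<i> * inner_L2 \<psi> v1)}"

text \<open>Action of A(v1,v2,alpha) (meaningful for x \<noteq> 0).\<close>
definition opA :: "(real \<Rightarrow> complex) \<Rightarrow> (real \<Rightarrow> complex) \<Rightarrow> real \<Rightarrow> (real \<Rightarrow> complex) \<Rightarrow> real \<Rightarrow> complex" where
  "opA v1 v2 \<alpha> \<psi> x = \<i> * vector_derivative \<psi> (at x)
     + v1 x * (lim_minus0 \<psi> + (\<i> / 2) * inner_L2 \<psi> v1)
     + v2 x * (lim_plus0 \<psi> - (\<i> / 2) * inner_L2 \<psi> v2)"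

definition L2_norm :: "(real \<Rightarrow> complex) \<Rightarrow> real" where
  "L2_norm f = sqrt (LINT x|lborel. (cmod (f x))^2)"

definition bounded_symmetric_L2 :: "((real \<Rightarrow> complex) \<Rightarrow> (real \<Rightarrow> complex)) \<Rightarrow> bool" where
  "bounded_symmetric_L2 K \<longleftrightarrow>
     (\<forall>\<psi>\<in>L2. K \<psi> \<in> L2) \<and>
     (\<exists>C. \<forall>\<psi>\<in>L2. L2_norm (K \<psi>) \<le> C * L2_norm \<psi>) \<and>
     (\<forall>\<psi>\<in>L2. \<forall>\<phi>\<in>L2. inner_L2 (K \<psi>) \<phi> = inner_L2 \<psi> (K \<phi>))"

end

theory Submission
  imports Defs
begin

text \<open>Since \<open>\<langle>\<psi>, e\<^sup>i\<^sup>\<alpha> v\<^sub>2\<rangle> = e\<^sup>-\<^sup>i\<^sup>\<alpha> \<langle>\<psi>, v\<^sub>2\<rangle>\<close>, the boundary condition reads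
  \<open>\<psi>(+0) - e\<^sup>i\<^sup>\<alpha> \<psi>(-0) = i e\<^sup>i\<^sup>\<alpha> \<langle>\<psi>, v\<rangle>\<close> with \<open>v = v\<^sub>1 + e\<^sup>i\<^sup>\<alpha> v\<^sub>2\<close>, so the domain depends only on \<open>v\<close>.
  Conversely, if two functions \<open>v\<close>, \<open>w\<close> give the same domain, then \<open>u = v - w\<close> is orthogonal to it.
  The domain is dense: any trapezoid can be corrected to satisfy the boundary condition by a bounded
  multiple of a spike to the right of \<open>0\<close>, which has height \<open>1\<close> and arbitrarily small \<open>L\<^sup>2\<close> norm.
  Hence \<open>u\<close> is orthogonal to all trapezoids, so its integral over every interval vanishes and
  \<open>u = 0\<close> almost everywhere. The difference formula is obtained by eliminating \<open>\<psi>(+0)\<close> with the boundary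
  condition, and the rank \<open>4\<close> difference by comparing both operators with \<open>A(v, 0, \<alpha>)\<close>.\<close>

lemma borel_measurable_cnj [measurable (raw)]:
  "f \<in> borel_measurable M \<Longrightarrow> (\<lambda>x. cnj (f x)) \<in> borel_measurable M"
  by (rule borel_measurable_continuous_on[OF continuous_on_cnj[OF continuous_on_id]])

section \<open>The space of square integrable functions\<close>

lemma L2_measurable: "f \<in> L2 \<Longrightarrow> f \<in> borel_measurable borel"
  by (simp add: L2_def)

lemma L2_integrable_square: "f \<in> L2 \<Longrightarrow> integrable lborel (\<lambda>x. (cmod (f x))\<^sup>2)"
  by (simp add: L2_def)

lemma L2_zero: "(\<lambda>_. 0) \<in> L2"
  by (simp add: L2_def)

lemma L2_scale:
  assumes "f \<in> L2"
  shows "(\<lambda>x. c * f x) \<in> L2"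
  using assms by (auto simp: L2_def norm_mult power_mult_distrib)

lemma L2_add:
  assumes "f \<in> L2" "g \<in> L2"
  shows "(\<lambda>x. f x + g x) \<in> L2"
proof -
  note [measurable] = assms[THEN L2_measurable]
  have "integrable lborel (\<lambda>x. (cmod (f x + g x))\<^sup>2)"
  proof (rule Bochner_Integration.integrable_bound)
    show "integrable lborel (\<lambda>x. 2 * (cmod (f x))\<^sup>2 + 2 * (cmod (g x))\<^sup>2)"
      using assms by (intro Bochner_Integration.integrable_add integrable_mult_right L2_integrable_square)
    have "(cmod (f x + g x))\<^sup>2 \<le> 2 * (cmod (f x))\<^sup>2 + 2 * (cmod (g x))\<^sup>2" for x
    proof -
      have "(cmod (f x + g x))\<^sup>2 \<le> (cmod (f x) + cmod (g x))\<^sup>2"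
        by (intro power_mono norm_triangle_ineq) auto
      also have "\<dots> \<le> 2 * (cmod (f x))\<^sup>2 + 2 * (cmod (g x))\<^sup>2"
        by (smt (verit) sum_squares_bound power2_sum)
      finally show ?thesis .
    qed
    then show "AE x in lborel. norm ((cmod (f x + g x))\<^sup>2) \<le> norm (2 * (cmod (f x))\<^sup>2 + 2 * (cmod (g x))\<^sup>2)"
      by simp
  qed measurable
  then show ?thesis by (simp add: L2_def)
qed

lemma L2_diff:
  assumes "f \<in> L2" "g \<in> L2"
  shows "(\<lambda>x. f x - g x) \<in> L2"
  using L2_add[OF assms(1) L2_scale[OF assms(2), of "-1"]] by simp

lemma L2_sum:
  fixes n :: nat
  assumes "\<And>k. k < n \<Longrightarrow> f k \<in> L2"
  shows "(\<lambda>x. \<Sum>k<n. f k x * c k) \<in> L2"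
  using assms
proof (induction n)
  case (Suc n)
  then show ?case
    using L2_add[of "\<lambda>x. \<Sum>k<n. f k x * c k" "\<lambda>x. c n * f n x"] L2_scale[of "f n" "c n"]
    by (simp add: mult.commute)
qed (simp add: L2_zero)

lemma L2_compact_support:
  fixes f :: "real \<Rightarrow> complex"
  assumes [measurable]: "f \<in> borel_measurable borel"
    and bound: "\<And>x. cmod (f x) \<le> B"
    and support: "\<And>x. x \<notin> {p..q} \<Longrightarrow> f x = 0"
  shows "f \<in> L2"
proof -
  have "integrable lborel (\<lambda>x. (cmod (f x))\<^sup>2)"
  proof (rule Bochner_Integration.integrable_bound)
    show "integrable lborel (\<lambda>x. indicat_real {p..q} x * B\<^sup>2)"
      by (intro integrable_mult_left integrable_real_indicator) (auto simp: emeasure_lborel_Icc_eq)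
    show "AE x in lborel. norm ((cmod (f x))\<^sup>2) \<le> norm (indicat_real {p..q} x * B\<^sup>2)"
      using bound support by (auto simp: indicator_def intro!: power_mono)
  qed measurable
  then show ?thesis by (simp add: L2_def)
qed

lemma L2_mult_integrable:
  assumes "f \<in> L2" "g \<in> L2"
  shows "integrable lborel (\<lambda>x. f x * cnj (g x))"
proof (rule Bochner_Integration.integrable_bound)
  note [measurable] = assms[THEN L2_measurable]
  show "integrable lborel (\<lambda>x. (cmod (f x))\<^sup>2 + (cmod (g x))\<^sup>2)"
    using assms by (intro Bochner_Integration.integrable_add L2_integrable_square)
  have "cmod (f x) * cmod (g x) \<le> (cmod (f x))\<^sup>2 + (cmod (g x))\<^sup>2" for x
    using sum_squares_bound[of "cmod (f x)" "cmod (g x)"]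
      mult_nonneg_nonneg[OF norm_ge_zero[of "f x"] norm_ge_zero[of "g x"]] by linarith
  then show "AE x in lborel. norm (f x * cnj (g x)) \<le> norm ((cmod (f x))\<^sup>2 + (cmod (g x))\<^sup>2)"
    by (simp add: norm_mult)
  show "(\<lambda>x. f x * cnj (g x)) \<in> borel_measurable lborel"
    by measurable
qed

section \<open>Sesquilinearity of the inner product\<close>

lemma inner_L2_add_left:
  "f \<in> L2 \<Longrightarrow> g \<in> L2 \<Longrightarrow> h \<in> L2 \<Longrightarrow> inner_L2 (\<lambda>x. f x + g x) h = inner_L2 f h + inner_L2 g h"
  unfolding inner_L2_def
  by (simp add: distrib_right L2_mult_integrable flip: Bochner_Integration.integral_add)

lemma inner_L2_scale_left: "inner_L2 (\<lambda>x. c * f x) h = c * inner_L2 f h"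
  unfolding inner_L2_def by (simp add: mult.assoc)

lemma inner_L2_zero: "inner_L2 (\<lambda>_. 0) h = 0" "inner_L2 h (\<lambda>_. 0) = 0"
  by (simp_all add: inner_L2_def)

lemma inner_L2_diff_left:
  "f \<in> L2 \<Longrightarrow> g \<in> L2 \<Longrightarrow> h \<in> L2 \<Longrightarrow> inner_L2 (\<lambda>x. f x - g x) h = inner_L2 f h - inner_L2 g h"
  using inner_L2_add_left[of f "\<lambda>x. -1 * g x" h] L2_scale[of g "-1"] inner_L2_scale_left[of "-1" g h]
  by simp

text \<open>Conjugation is a bounded real-linear involution, so the integral commutes with it
  whether or not the product is integrable. Rules for the second argument follow from those for the
  first.\<close>

lemma inner_L2_cnj: "inner_L2 g f = cnj (inner_L2 f g)"
proof -
  have "cnj (inner_L2 f g) = (LINT x|lborel. cnj (f x * cnj (g x)))"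
    unfolding inner_L2_def
    by (intro integral_bounded_linear'[OF bounded_linear_cnj bounded_linear_cnj, symmetric]) simp
  then show ?thesis by (simp add: inner_L2_def mult.commute)
qed

lemma inner_L2_add_right:
  "f \<in> L2 \<Longrightarrow> g \<in> L2 \<Longrightarrow> h \<in> L2 \<Longrightarrow> inner_L2 h (\<lambda>x. f x + g x) = inner_L2 h f + inner_L2 h g"
  by (subst (1 2 3) inner_L2_cnj) (simp add: inner_L2_add_left)

lemma inner_L2_diff_right:
  "f \<in> L2 \<Longrightarrow> g \<in> L2 \<Longrightarrow> h \<in> L2 \<Longrightarrow> inner_L2 h (\<lambda>x. f x - g x) = inner_L2 h f - inner_L2 h g"
  by (subst (1 2 3) inner_L2_cnj) (simp add: inner_L2_diff_left)

lemma inner_L2_scale_right: "inner_L2 h (\<lambda>x. c * f x) = cnj c * inner_L2 h f"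
  by (subst (1 2) inner_L2_cnj) (simp add: inner_L2_scale_left)

lemma inner_L2_sum_left:
  fixes n :: nat
  assumes "\<And>k. k < n \<Longrightarrow> f k \<in> L2" "h \<in> L2"
  shows "inner_L2 (\<lambda>x. \<Sum>k<n. f k x * c k) h = (\<Sum>k<n. c k * inner_L2 (f k) h)"
  using assms
proof (induction n)
  case (Suc n)
  have "inner_L2 (\<lambda>x. (\<Sum>k<n. f k x * c k) + c n * f n x) h
      = inner_L2 (\<lambda>x. \<Sum>k<n. f k x * c k) h + inner_L2 (\<lambda>x. c n * f n x) h"
    using Suc.prems by (intro inner_L2_add_left L2_sum L2_scale) auto
  then show ?case
    using Suc by (simp add: inner_L2_scale_left mult.commute)
qed (simp add: inner_L2_zero)

lemma inner_L2_cong_AE: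
  assumes "g \<in> L2" "h \<in> L2" "\<psi> \<in> L2" "AE x in lborel. g x = h x"
  shows "inner_L2 \<psi> g = inner_L2 \<psi> h"
proof -
  note [measurable] = assms(1-3)[THEN L2_measurable]
  show ?thesis
    unfolding inner_L2_def using assms(4) by (intro integral_cong_AE) auto
qed

section \<open>The norm and the Cauchy-Schwarz inequality\<close>

lemma L2_norm_nonneg: "0 \<le> L2_norm f"
  by (simp add: L2_norm_def)

lemma L2_norm_square: "of_real ((L2_norm f)\<^sup>2) = inner_L2 f f"
proof -
  have "inner_L2 f f = (LINT x|lborel. complex_of_real ((cmod (f x))\<^sup>2))"
    unfolding inner_L2_def by (simp add: complex_norm_square del: of_real_power)
  then show ?thesis
    by (simp add: L2_norm_def del: of_real_power)
qed

text \<open>Passing to absolute values reduces this to the inequality for nonnegative integrals;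
  integrability of the product and of both squares allows the return to real integrals.\<close>

lemma Cauchy_Schwarz_L2:
  assumes "f \<in> L2" "g \<in> L2"
  shows "cmod (inner_L2 f g) \<le> L2_norm f * L2_norm g"
proof -
  note [measurable] = assms[THEN L2_measurable]
  let ?I = "\<integral>x. cmod (f x) * cmod (g x) \<partial>lborel"
  have int: "integrable lborel (\<lambda>x. cmod (f x) * cmod (g x))"
    using integrable_norm[OF L2_mult_integrable[OF assms]] by (simp add: norm_mult)
  have "cmod (inner_L2 f g) \<le> ?I"
    unfolding inner_L2_def using integral_norm_bound[of lborel "\<lambda>x. f x * cnj (g x)"]
    by (simp add: norm_mult)
  moreover have "?I\<^sup>2 \<le> (LINT x|lborel. (cmod (f x))\<^sup>2) * (LINT x|lborel. (cmod (g x))\<^sup>2)"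
  proof -
    have "ennreal (?I\<^sup>2) = (\<integral>\<^sup>+x. ennreal (cmod (f x)) * ennreal (cmod (g x)) \<partial>lborel)\<^sup>2"
      using nn_integral_eq_integral[OF int]
      by (simp add: ennreal_mult ennreal_power)
    also have "\<dots> \<le> (\<integral>\<^sup>+x. (ennreal (cmod (f x)))\<^sup>2 \<partial>lborel) * (\<integral>\<^sup>+x. (ennreal (cmod (g x)))\<^sup>2 \<partial>lborel)"
      by (rule Cauchy_Schwarz_nn_integral) measurable
    also have "\<dots> = ennreal ((LINT x|lborel. (cmod (f x))\<^sup>2) * (LINT x|lborel. (cmod (g x))\<^sup>2))"
      using assms[THEN L2_integrable_square]
      by (simp add: ennreal_power ennreal_mult nn_integral_eq_integral)
    finally show ?thesis by (simp add: ennreal_le_iff)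
  qed
  then have "?I \<le> L2_norm f * L2_norm g"
    unfolding L2_norm_def real_sqrt_mult[symmetric] by (rule real_le_rsqrt)
  ultimately show ?thesis by linarith
qed

section \<open>Finite rank operators\<close>

text \<open>The adjoint of \<open>f k * \<langle>_, g k\<rangle>\<close> exchanges
  \<open>f k\<close> and \<open>g k\<close>, so symmetry amounts to invariance of the whole sum
  under this exchange, which is \<open>sym\<close>.\<close>

lemma bounded_symmetric_finite_rank:
  fixes n :: nat
  assumes f: "\<And>k. k < n \<Longrightarrow> f k \<in> L2" and g: "\<And>k. k < n \<Longrightarrow> g k \<in> L2"
    and sym: "\<And>\<psi> \<phi>. \<psi> \<in> L2 \<Longrightarrow> \<phi> \<in> L2 \<Longrightarrow>
      (\<Sum>k<n. inner_L2 \<psi> (g k) * inner_L2 (f k) \<phi>) = (\<Sum>k<n. inner_L2 \<psi> (f k) * inner_L2 (g k) \<phi>)"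
  shows "bounded_symmetric_L2 (\<lambda>\<psi> x. \<Sum>k<n. f k x * inner_L2 \<psi> (g k))"
proof -
  define K where "K = (\<lambda>\<psi> x. \<Sum>k<n. f k x * inner_L2 \<psi> (g k))"
  define C where "C = (\<Sum>k<n. L2_norm (g k) * L2_norm (f k))"
  have K: "K \<psi> \<in> L2" for \<psi>
    unfolding K_def using f by (rule L2_sum)
  have inner_K: "inner_L2 (K \<psi>) \<phi> = (\<Sum>k<n. inner_L2 \<psi> (g k) * inner_L2 (f k) \<phi>)" if "\<phi> \<in> L2" for \<psi> \<phi>
    unfolding K_def using f that by (rule inner_L2_sum_left)
  have "L2_norm (K \<psi>) \<le> C * L2_norm \<psi>" if \<psi>: "\<psi> \<in> L2" for \<psi>
  proof -
    \<comment> \<open>Expanding only the first argument of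
      \<open>\<langle>K \<psi>, K \<psi>\<rangle>\<close> leaves a factor
      \<open>L2_norm (K \<psi>)\<close> on the right to divide out, so no triangle inequality for
      the norm is required.\<close>
    have "(L2_norm (K \<psi>))\<^sup>2 = cmod (inner_L2 (K \<psi>) (K \<psi>))"
      by (simp flip: L2_norm_square add: norm_power L2_norm_nonneg)
    also have "\<dots> \<le> (\<Sum>k<n. cmod (inner_L2 \<psi> (g k)) * cmod (inner_L2 (f k) (K \<psi>)))"
      unfolding inner_K[OF K] by (rule order_trans[OF norm_sum]) (simp add: norm_mult)
    also have "\<dots> \<le> (\<Sum>k<n. (L2_norm \<psi> * L2_norm (g k)) * (L2_norm (f k) * L2_norm (K \<psi>)))"
      using f g K \<psi> by (intro sum_mono mult_mono Cauchy_Schwarz_L2) (auto simp: L2_norm_nonneg)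
    also have "\<dots> = (C * L2_norm \<psi>) * L2_norm (K \<psi>)"
      by (simp add: C_def sum_distrib_left sum_distrib_right mult_ac)
    finally have *: "L2_norm (K \<psi>) * L2_norm (K \<psi>) \<le> (C * L2_norm \<psi>) * L2_norm (K \<psi>)"
      by (simp add: power2_eq_square)
    \<comment> \<open>Covers the case \<open>L2_norm (K \<psi>) = 0\<close>, where division is
      impossible.\<close>
    have "0 \<le> C * L2_norm \<psi>"
      unfolding C_def by (intro mult_nonneg_nonneg sum_nonneg L2_norm_nonneg)
    with * show ?thesis
      using L2_norm_nonneg[of "K \<psi>"] by (cases "L2_norm (K \<psi>) = 0") auto
  qed
  moreover have "inner_L2 (K \<psi>) \<phi> = inner_L2 \<psi> (K \<phi>)" if "\<psi> \<in> L2" "\<phi> \<in> L2" for \<psi> \<phi>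
  proof -
    have "inner_L2 \<psi> (K \<phi>) = cnj (\<Sum>k<n. inner_L2 \<phi> (g k) * inner_L2 (f k) \<psi>)"
      using inner_L2_cnj[of \<psi> "K \<phi>"] inner_K[OF that(1)] by simp
    also have "\<dots> = (\<Sum>k<n. inner_L2 \<psi> (f k) * inner_L2 (g k) \<phi>)"
      by (simp add: inner_L2_cnj[of \<psi>] inner_L2_cnj[of _ \<phi>] mult.commute)
    finally show ?thesis
      using sym[OF that] inner_K[OF that(2)] by simp
  qed
  ultimately have "bounded_symmetric_L2 K"
    unfolding bounded_symmetric_L2_def using K by blast
  then show ?thesis by (simp add: K_def)
qed

section \<open>Vanishing of a function with vanishing integrals over intervals\<close>

text \<open>A Dynkin system argument: the sets with vanishing integral contain the half-lines, an
  intersection-stable generator of the Borel sets, and are closed under complements and countable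
  disjoint unions.\<close>

lemma AE_zero_if_interval_integrals_zero:
  fixes h :: "real \<Rightarrow> complex"
  assumes int: "\<And>a b. set_integrable lborel {a<..b} h"
    and zero: "\<And>a b. a < b \<Longrightarrow> (LINT x:{a<..b}|lborel. h x) = 0"
  shows "AE x in lborel. h x = 0"
proof -
  \<comment> \<open>\<open>h\<close> is only integrable on bounded intervals; cutting it off to a
    window makes it integrable on the line, and countably many windows exhaust the line.\<close>
  have "AE x in lborel. indicator {- real N<..real N} x *\<^sub>R h x = 0" for N
  proof (rule sigma_finite_measure.density_zero[OF lborel.sigma_finite_measure_axioms])
    let ?h = "\<lambda>x. indicator {- real N<..real N} x *\<^sub>R h x"
    \<comment> \<open>Empty intervals are included because a half-line \<open>{..c}\<close> may miss
      the window.\<close>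
    have zero': "(LINT x:{a<..b}|lborel. h x) = 0" for a b
      using zero[of a b] by (cases "a < b") (auto simp: set_lebesgue_integral_def)
    show h: "integrable lborel ?h"
      using int[of "- real N" "real N"] by (simp add: set_integrable_def)
    have sint: "set_integrable lborel A ?h" if "A \<in> sets borel" for A
      unfolding set_integrable_def using that by (intro integrable_mult_indicator h) simp
    \<comment> \<open>The integral over the whole line settles complements.\<close>
    have full: "(LINT x|lborel. ?h x) = 0"
      using zero'[of "- real N" "real N"] by (simp add: set_lebesgue_integral_def)
    fix A :: "real set"
    assume "A \<in> sets lborel"
    then have "A \<in> sigma_sets UNIV (range atMost)"
      by (simp add: borel_eq_atMost)
    then show "(LINT x:A|lborel. ?h x) = 0"
    proof (induction rule: sigma_sets_induct_disjoint[rotated 2, consumes 1])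
      show "Int_stable (range (atMost :: real \<Rightarrow> real set))"
        by (auto simp: Int_stable_def)
    next
      fix B assume "B \<in> range (atMost :: real \<Rightarrow> real set)"
      then obtain c where B: "B = {..c}" by auto
      have "(LINT x:B|lborel. ?h x) = (LINT x:{- real N<..min c (real N)}|lborel. h x)"
        unfolding set_lebesgue_integral_def B
        by (rule Bochner_Integration.integral_cong) (auto simp: indicator_def)
      then show "(LINT x:B|lborel. ?h x) = 0" by (simp add: zero')
    next
      show "(LINT x:{}|lborel. ?h x) = 0" by (simp add: set_lebesgue_integral_def)
    next
      fix B assume "B \<in> sigma_sets UNIV (range (atMost :: real \<Rightarrow> real set))"
        and B0: "(LINT x:B|lborel. ?h x) = 0"
      then have B: "B \<in> sets borel"
        by (simp add: borel_eq_atMost)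
      have "(LINT x:UNIV - B|lborel. ?h x) = (LINT x|lborel. ?h x - indicator B x *\<^sub>R ?h x)"
        unfolding set_lebesgue_integral_def
        by (rule Bochner_Integration.integral_cong) (auto simp: indicator_def)
      also have "\<dots> = (LINT x|lborel. ?h x) - (LINT x:B|lborel. ?h x)"
        unfolding set_lebesgue_integral_def using h sint[OF B]
        by (intro Bochner_Integration.integral_diff) (simp_all add: set_integrable_def)
      finally show "(LINT x:UNIV - B|lborel. ?h x) = 0" using B0 full by simp
    next
      fix D :: "nat \<Rightarrow> real set"
      assume disj: "disjoint_family D"
        and "range D \<subseteq> sigma_sets UNIV (range (atMost :: real \<Rightarrow> real set))"
        and D0: "\<And>i. (LINT x:D i|lborel. ?h x) = 0"
      then have D: "\<And>i. D i \<in> sets borel"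
        by (auto simp: borel_eq_atMost)
      have "(LINT x:(\<Union>i. D i)|lborel. ?h x) = (\<Sum>i. (LINT x:D i|lborel. ?h x))"
        using D disj by (intro lebesgue_integral_countable_add sint)
          (auto simp: disjoint_family_on_def)
      then show "(LINT x:(\<Union>i. D i)|lborel. ?h x) = 0" by (simp add: D0)
    qed auto
  qed
  then have "AE x in lborel. \<forall>N. indicator {- real N<..real N} x *\<^sub>R h x = 0"
    unfolding AE_all_countable by blast
  then show ?thesis
  proof eventually_elim
    case (elim x)
    obtain N where "\<bar>x\<bar> < real N" using reals_Archimedean2 by blast
    then show ?case using elim[rule_format, of N] by (auto simp: indicator_def abs_less_iff)
  qed
qed


section \<open>Test functions with a jump at the origin\<close>

text \<open>The fundamental theorem of calculus tolerates finitely many corners, and an interval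
  inside one half-line never meets the jump at 0.\<close>

lemma W21_OmegaI:
  assumes "\<psi> \<in> L2" "g \<in> L2" "finite S"
    and cont: "continuous_on {0<..} \<psi>" "continuous_on {..<0} \<psi>"
    and deriv: "\<And>x. x \<notin> S \<Longrightarrow> (\<psi> has_vector_derivative g x) (at x)"
  shows "\<psi> \<in> W21_Omega"
proof -
  have "\<psi> y - \<psi> x = integral {x..y} g" if "x \<le> y" "0 < x \<or> y < 0" for x y
  proof -
    have "continuous_on {x..y} \<psi>"
      using that cont by (auto intro: continuous_on_subset)
    then have "(g has_integral (\<psi> y - \<psi> x)) {x..y}"
      using that assms(3) deriv by (intro fundamental_theorem_of_calculus_interior_strong[of S]) auto
    then show ?thesis by (simp add: integral_unique)
  qed
  then show ?thesis using assms(1,2) by (auto simp: W21_Omega_def)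
qed

text \<open>A continuous version of the indicator of \<open>{..a}\<close>: for \<open>m > 0\<close>
  it is 1 up to \<open>a\<close>, falls with slope \<open>-m\<close>, and is 0 from
  \<open>a + 1 / m\<close> on.\<close>

definition ramp :: "real \<Rightarrow> real \<Rightarrow> real \<Rightarrow> real" where
  "ramp m a x = max 0 (1 - m * max 0 (x - a))"

lemma ramp_continuous: "continuous_on S (ramp m a)"
  unfolding ramp_def by (intro continuous_intros)

lemma ramp_measurable [measurable]: "ramp m a \<in> borel_measurable borel"
  by (intro borel_measurable_continuous_onI ramp_continuous)

lemma ramp_bounds: "0 \<le> m \<Longrightarrow> 0 \<le> ramp m a x" "0 \<le> m \<Longrightarrow> ramp m a x \<le> 1"
  by (auto simp: ramp_def)

lemma ramp_left: "x \<le> a \<Longrightarrow> ramp m a x = 1"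
  by (simp add: ramp_def)

lemma ramp_right: "0 < m \<Longrightarrow> a + 1 / m \<le> x \<Longrightarrow> ramp m a x = 0"
proof -
  assume *: "0 < m" "a + 1 / m \<le> x"
  then have "1 \<le> m * (x - a)" by (simp add: field_simps)
  also have "\<dots> \<le> m * max 0 (x - a)" using * by (intro mult_left_mono) auto
  finally show ?thesis by (simp add: ramp_def)
qed

lemma ramp_tendsto: "(\<lambda>n. ramp (real (Suc n)) a x) \<longlonglongrightarrow> indicator {..a} x"
proof (cases "x \<le> a")
  case True
  then show ?thesis by (simp add: ramp_left)
next
  case False
  \<comment> \<open>From such \<open>n\<close> on, the foot \<open>a + 1 / (n + 1)\<close> of the
    ramp lies to the left of \<open>x\<close>.\<close>
  then have "\<forall>\<^sub>F n in sequentially. 1 / (x - a) < real n"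
    using filterlim_real_sequentially by (auto simp: filterlim_at_top_dense)
  then have "\<forall>\<^sub>F n in sequentially. ramp (real (Suc n)) a x = 0"
  proof eventually_elim
    case (elim n)
    then have "1 / real (Suc n) \<le> x - a" using False by (simp add: field_simps)
    then show ?case by (intro ramp_right) auto
  qed
  then show ?thesis using False by (simp add: tendsto_eventually)
qed

lemma ramp_has_derivative:
  assumes "0 < m" "x \<noteq> a" "x \<noteq> a + 1 / m"
  shows "(ramp m a has_real_derivative (if a < x \<and> x < a + 1 / m then - m else 0)) (at x)"
proof -
  consider "x < a" | "a < x" "x < a + 1 / m" | "a + 1 / m < x" using assms by linarith
  then show ?thesis
  proof cases
    case 1
    have "((\<lambda>_. 1) has_real_derivative 0) (at x)" by simp
    then have "(ramp m a has_real_derivative 0) (at x)"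
      by (rule has_field_derivative_transform_within_open[of _ _ _ "{..<a}"])
        (use 1 in \<open>auto simp: ramp_left\<close>)
    then show ?thesis using 1 by simp
  next
    case 2
    have "((\<lambda>x. 1 - m * (x - a)) has_real_derivative - m) (at x)"
      by (auto intro!: derivative_eq_intros)
    then have "(ramp m a has_real_derivative - m) (at x)"
      by (rule has_field_derivative_transform_within_open[of _ _ _ "{a<..<a + 1 / m}"])
        (use 2 assms(1) in \<open>auto simp: ramp_def max_def field_simps\<close>)
    then show ?thesis using 2 by simp
  next
    case 3
    have "((\<lambda>_. 0) has_real_derivative 0) (at x)" by simp
    then have "(ramp m a has_real_derivative 0) (at x)"
      by (rule has_field_derivative_transform_within_open[of _ _ _ "{a + 1 / m<..}"])
        (use 3 assms(1) in \<open>auto simp: ramp_right\<close>)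
    moreover have "0 < 1 / m" using assms(1) by simp
    ultimately show ?thesis using 3 by simp
  qed
qed

text \<open>For large \<open>m\<close> it rises from 0 to 1 just after \<open>a\<close> and falls
  back just after \<open>b\<close>, approximating the indicator of \<open>{a<..b}\<close>.\<close>

definition trapezoid :: "real \<Rightarrow> real \<Rightarrow> real \<Rightarrow> real \<Rightarrow> complex" where
  "trapezoid m a b x = of_real (ramp m b x - ramp m a x)"

text \<open>It jumps from 0 to 1 at the origin and is 0 again from \<open>1 / m\<close> on, so its
  squared norm is \<open>1 / (3 * m)\<close> for \<open>m > 0\<close>.\<close>

definition spike :: "real \<Rightarrow> real \<Rightarrow> complex" where
  "spike m x = of_real (indicator {0<..} x * ramp m 0 x)"

lemma trapezoid_measurable [measurable]: "trapezoid m a b \<in> borel_measurable borel"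
  unfolding trapezoid_def by measurable

lemma spike_measurable [measurable]: "spike m \<in> borel_measurable borel"
  unfolding spike_def by measurable

text \<open>The slopes have width \<open>1 / m \<le> 1\<close>, which gives a majorant independent
  of \<open>m\<close>, as dominated convergence requires.\<close>

lemma trapezoid_bound:
  assumes "1 \<le> m" "a < b"
  shows "cmod (trapezoid m a b x) \<le> indicator {a..b + 1} x"
proof (cases "x \<in> {a..b + 1}")
  case True
  then show ?thesis
    using ramp_bounds[of m a x] ramp_bounds[of m b x] assms
    unfolding trapezoid_def norm_of_real by (auto simp: indicator_def)
next
  case False
  have "1 / m \<le> 1" using assms by simp
  then have "b + 1 < x \<Longrightarrow> a + 1 / m \<le> x \<and> b + 1 / m \<le> x" using assms by linarith
  then have "x < a \<or> ramp m a x = 0 \<and> ramp m b x = 0"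
    using False assms ramp_right[of m a x] ramp_right[of m b x] by auto
  then show ?thesis
    using assms unfolding trapezoid_def norm_of_real by (auto simp: ramp_left indicator_def)
qed

lemma spike_bound:
  assumes "1 \<le> m"
  shows "cmod (spike m x) \<le> indicator {0..1} x"
proof (cases "x \<in> {0..1}")
  case True
  then show ?thesis
    using ramp_bounds[of m 0 x] assms unfolding spike_def norm_of_real
    by (auto simp: indicator_def)
next
  case False
  have "1 / m \<le> 1" using assms by simp
  then have "1 < x \<Longrightarrow> 0 + 1 / m \<le> x" by linarith
  then have "x < 0 \<or> ramp m 0 x = 0"
    using False assms ramp_right[of m 0 x] by auto
  then show ?thesis unfolding spike_def norm_of_real by (auto simp: indicator_def)
qed

lemma L2_indicator: "(\<lambda>x. complex_of_real (indicator {p..q} x)) \<in> L2"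
  by (rule L2_compact_support[of _ 1 p q]) (auto simp: indicator_def)

lemma L2_dominated_by_indicator:
  fixes f :: "real \<Rightarrow> complex"
  assumes "f \<in> borel_measurable borel" and bound: "\<And>x. cmod (f x) \<le> indicator {p..q} x"
  shows "f \<in> L2"
proof (rule L2_compact_support[OF assms(1)])
  fix x
  show "cmod (f x) \<le> 1"
    using bound[of x] by (rule order_trans) (simp add: indicator_def)
  show "f x = 0" if "x \<notin> {p..q}"
    using bound[of x] that by simp
qed

lemma trapezoid_L2: "1 \<le> m \<Longrightarrow> a < b \<Longrightarrow> trapezoid m a b \<in> L2"
  by (rule L2_dominated_by_indicator[OF trapezoid_measurable trapezoid_bound])

lemma spike_L2: "1 \<le> m \<Longrightarrow> spike m \<in> L2"
  by (rule L2_dominated_by_indicator[OF spike_measurable spike_bound])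

text \<open>The function is piecewise affine and its only possible jump is at 0. The weak derivative
  \<open>g\<close> is assembled from the slopes \<open>r\<close> of the three ramps;
  \<open>S\<close> collects their corners, among them 0.\<close>

lemma jump_test_function_W21:
  assumes "1 \<le> m" "1 \<le> n" "a < b"
  shows "(\<lambda>x. trapezoid m a b x - c * spike n x) \<in> W21_Omega"
proof -
  define r where "r = (\<lambda>m a x. if a < x \<and> x < a + 1 / m then - m else (0::real))"
  define g where "g = (\<lambda>x. complex_of_real (r m b x - r m a x) - c * of_real (r n 0 x))"
  define S where "S = {a, a + 1 / m, b, b + 1 / m, 0, 0 + 1 / n}"
  have [measurable]: "r m a \<in> borel_measurable borel" for m a
    unfolding r_def by measurable
  have rL2: "(\<lambda>x. complex_of_real (r m a x)) \<in> L2" for m a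
    by (rule L2_compact_support[of _ "\<bar>m\<bar>" a "a + 1 / m"]) (auto simp: r_def)
  show ?thesis
  proof (rule W21_OmegaI[of _ g S])
    show "(\<lambda>x. trapezoid m a b x - c * spike n x) \<in> L2"
      using assms by (intro L2_diff L2_scale trapezoid_L2 spike_L2)
    have "(\<lambda>x. (complex_of_real (r m b x) - of_real (r m a x)) - c * of_real (r n 0 x)) \<in> L2"
      by (intro L2_diff L2_scale rL2)
    then show "g \<in> L2" by (simp add: g_def)
    show "finite S" by (simp add: S_def)
    have cont: "continuous_on A (trapezoid m a b)" for A
      unfolding trapezoid_def by (intro continuous_intros ramp_continuous)
    have "continuous_on {0<..} (\<lambda>x. trapezoid m a b x - c * of_real (ramp n 0 x))"
      by (intro continuous_intros ramp_continuous cont)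
    then show "continuous_on {0<..} (\<lambda>x. trapezoid m a b x - c * spike n x)"
      by (rule continuous_on_eq) (simp add: spike_def)
    show "continuous_on {..<0} (\<lambda>x. trapezoid m a b x - c * spike n x)"
      by (rule continuous_on_eq[OF cont]) (simp add: spike_def)
    fix x assume x: "x \<notin> S"
    have ramp: "((\<lambda>x. complex_of_real (ramp m a x)) has_vector_derivative of_real (r m a x)) (at x)"
      if "1 \<le> m" "x \<noteq> a" "x \<noteq> a + 1 / m" for m a
      using ramp_has_derivative[of m x a] that unfolding r_def
      by (intro has_vector_derivative_of_real)
        (auto simp: has_real_derivative_iff_has_vector_derivative)
    have "(spike n has_vector_derivative of_real (r n 0 x)) (at x)"
    proof (cases "0 < x")
      case True
      have "((\<lambda>x. complex_of_real (ramp n 0 x)) has_vector_derivative of_real (r n 0 x)) (at x)"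
        using x assms by (intro ramp) (auto simp: S_def)
      then show ?thesis
        by (rule has_vector_derivative_transform_within_open[of _ _ _ "{0<..}"])
          (use True in \<open>auto simp: spike_def\<close>)
    next
      case False
      then have "x < 0" using x by (auto simp: S_def)
      moreover have "((\<lambda>_. 0) has_vector_derivative 0) (at x)" by simp
      then have "(spike n has_vector_derivative 0) (at x)"
        by (rule has_vector_derivative_transform_within_open[of _ _ _ "{..<0}"])
          (use \<open>x < 0\<close> in \<open>auto simp: spike_def\<close>)
      ultimately show ?thesis by (simp add: r_def)
    qed
    moreover have "(trapezoid m a b has_vector_derivative of_real (r m b x - r m a x)) (at x)"
      unfolding trapezoid_def of_real_diff
      using x assms by (intro has_vector_derivative_diff ramp) (auto simp: S_def)
    ultimately show "((\<lambda>x. trapezoid m a b x - c * spike n x) has_vector_derivative g x) (at x)"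
      unfolding g_def by (intro has_vector_derivative_diff has_vector_derivative_mult_right)
  qed
qed

section \<open>One-sided limits of the test functions at the origin\<close>

lemma trapezoid_isCont: "isCont (trapezoid m a b) x"
  unfolding trapezoid_def
  using ramp_continuous[of UNIV] by (intro continuous_intros) (auto simp: continuous_on_eq_continuous_at)

lemma lim_plus0_jump_test_function:
  assumes "1 \<le> n"
  shows "lim_plus0 (\<lambda>x. trapezoid m a b x - c * spike n x) = trapezoid m a b 0 - c"
proof -
  have "(ramp n 0 \<longlongrightarrow> ramp n 0 0) (at 0)"
    using ramp_continuous[of UNIV n 0] by (auto simp: continuous_on_eq_continuous_at isCont_def)
  then have "((\<lambda>x. complex_of_real (ramp n 0 x)) \<longlongrightarrow> of_real 1) (at_right 0)"
    by (intro tendsto_of_real) (auto simp: ramp_left intro: tendsto_within_subset)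
  \<comment> \<open>At 0 itself the ramp is 1 and the spike 0, but \<open>at_right 0\<close>
    excludes that point.\<close>
  moreover have "\<forall>\<^sub>F x in at_right 0. complex_of_real (ramp n 0 x) = spike n x"
    unfolding eventually_at_filter by (rule always_eventually) (simp add: spike_def)
  ultimately have "(spike n \<longlongrightarrow> 1) (at_right 0)"
    by (simp add: Lim_transform_eventually)
  moreover have "(trapezoid m a b \<longlongrightarrow> trapezoid m a b 0) (at_right 0)"
    using trapezoid_isCont[where x = 0] unfolding isCont_def by (rule tendsto_within_subset) simp
  ultimately have "((\<lambda>x. trapezoid m a b x - c * spike n x) \<longlongrightarrow> trapezoid m a b 0 - c * 1) (at_right 0)"
    by (intro tendsto_intros)
  then show ?thesis unfolding lim_plus0_def by (simp add: tendsto_Lim)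
qed

lemma lim_minus0_jump_test_function:
  "lim_minus0 (\<lambda>x. trapezoid m a b x - c * spike n x) = trapezoid m a b 0"
proof -
  have "(trapezoid m a b \<longlongrightarrow> trapezoid m a b 0) (at_left 0)"
    using trapezoid_isCont[where x = 0] unfolding isCont_def by (rule tendsto_within_subset) simp
  moreover have "\<forall>\<^sub>F x in at_left 0. trapezoid m a b x = trapezoid m a b x - c * spike n x"
    unfolding eventually_at_filter by (rule always_eventually) (simp add: spike_def)
  ultimately have "((\<lambda>x. trapezoid m a b x - c * spike n x) \<longlongrightarrow> trapezoid m a b 0) (at_left 0)"
    by (rule Lim_transform_eventually)
  then show ?thesis unfolding lim_minus0_def by (simp add: tendsto_Lim)
qed

text \<open>Dominated convergence with majorant \<open>cmod (h x * cnj (u x))\<close>, integrable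
  because both factors are square integrable.\<close>

lemma inner_L2_dominated_limit:
  assumes "u \<in> L2" "h \<in> L2" "f \<in> L2" "\<And>n. t n \<in> L2"
    and bound: "\<And>n x. cmod (t n x) \<le> cmod (h x)"
    and lim: "\<And>x. (\<lambda>n. t n x) \<longlonglongrightarrow> f x"
  shows "(\<lambda>n. inner_L2 (t n) u) \<longlonglongrightarrow> inner_L2 f u"
  unfolding inner_L2_def
proof (rule integral_dominated_convergence)
  note [measurable] = assms(1-4)[THEN L2_measurable]
  show "(\<lambda>x. f x * cnj (u x)) \<in> borel_measurable lborel"
    "(\<lambda>x. t n x * cnj (u x)) \<in> borel_measurable lborel" for n
    by measurable
  show "integrable lborel (\<lambda>x. cmod (h x * cnj (u x)))"
    by (intro integrable_norm L2_mult_integrable assms)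
  show "AE x in lborel. (\<lambda>n. t n x * cnj (u x)) \<longlonglongrightarrow> f x * cnj (u x)"
    using lim by (auto intro!: tendsto_intros)
  show "AE x in lborel. norm (t n x * cnj (u x)) \<le> cmod (h x * cnj (u x))" for n
    using bound by (simp add: norm_mult mult_right_mono)
qed

lemma inner_spike_tendsto:
  assumes "u \<in> L2"
  shows "(\<lambda>n. inner_L2 (spike (real (Suc n))) u) \<longlonglongrightarrow> 0"
proof -
  have "(\<lambda>n. inner_L2 (spike (real (Suc n))) u) \<longlonglongrightarrow> inner_L2 (\<lambda>_. 0) u"
  proof (rule inner_L2_dominated_limit[OF assms L2_indicator[of 0 1] L2_zero])
    fix n x
    show "spike (real (Suc n)) \<in> L2" by (rule spike_L2) simp
    show "cmod (spike (real (Suc n)) x) \<le> cmod (complex_of_real (indicator {0..1} x))"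
      using spike_bound[of "real (Suc n)" x] by simp
    \<comment> \<open>The limit is an indicator product over disjoint sets, hence 0 at every point,
      including the origin.\<close>
    have "(\<lambda>n. spike (real (Suc n)) x) \<longlonglongrightarrow> of_real (indicator {0<..} x * indicator {..0} x)"
      unfolding spike_def by (intro tendsto_intros ramp_tendsto)
    then show "(\<lambda>n. spike (real (Suc n)) x) \<longlonglongrightarrow> 0"
      by (cases "0 < x") (simp_all del: of_nat_Suc)
  qed
  then show ?thesis by (simp add: inner_L2_zero)
qed

lemma inner_trapezoid_tendsto:
  assumes "u \<in> L2" "a < b"
  shows "(\<lambda>n. inner_L2 (trapezoid (real (Suc n)) a b) u) \<longlonglongrightarrow> (LINT x:{a<..b}|lborel. cnj (u x))"
proof -
  let ?f = "\<lambda>x. complex_of_real (indicator {a<..b} x)"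
  have f: "?f \<in> L2"
    by (rule L2_compact_support[of _ 1 a b]) (auto simp: indicator_def)
  have "(\<lambda>n. inner_L2 (trapezoid (real (Suc n)) a b) u) \<longlonglongrightarrow> inner_L2 ?f u"
  proof (rule inner_L2_dominated_limit[OF assms(1) L2_indicator[of a "b + 1"] f])
    fix n x
    show "trapezoid (real (Suc n)) a b \<in> L2" using assms by (intro trapezoid_L2) simp_all
    show "cmod (trapezoid (real (Suc n)) a b x) \<le> cmod (complex_of_real (indicator {a..b + 1} x))"
      using trapezoid_bound[of "real (Suc n)" a b x] assms(2) by simp
    have "(\<lambda>n. trapezoid (real (Suc n)) a b x) \<longlonglongrightarrow> of_real (indicator {..b} x - indicator {..a} x)"
      unfolding trapezoid_def by (intro tendsto_intros ramp_tendsto)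
    then show "(\<lambda>n. trapezoid (real (Suc n)) a b x) \<longlonglongrightarrow> ?f x"
      using assms(2) by (cases "a < x"; cases "x \<le> b") (simp_all del: of_nat_Suc)
  qed
  moreover have "inner_L2 ?f u = (LINT x:{a<..b}|lborel. cnj (u x))"
    unfolding inner_L2_def set_lebesgue_integral_def by (simp add: scaleR_conv_of_real)
  ultimately show ?thesis by simp
qed

section \<open>The boundary condition\<close>

lemma W21_Omega_L2: "\<psi> \<in> W21_Omega \<Longrightarrow> \<psi> \<in> L2"
  by (simp add: W21_Omega_def)

lemma exp_i_cnj: "cnj (exp (\<i> * of_real \<alpha>)) = exp (- \<i> * of_real \<alpha>)"
  by (simp add: exp_cnj)

lemma exp_i_inverse: "exp (\<i> * of_real \<alpha>) * exp (- \<i> * of_real \<alpha>) = 1"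
  by (simp flip: exp_add)

lemma inner_L2_combination:
  assumes "\<psi> \<in> L2" "v1 \<in> L2" "v2 \<in> L2"
  shows "inner_L2 \<psi> (\<lambda>x. v1 x + exp (\<i> * of_real \<alpha>) * v2 x)
    = inner_L2 \<psi> v1 + exp (- \<i> * of_real \<alpha>) * inner_L2 \<psi> v2"
  using assms by (simp only: inner_L2_add_right L2_scale inner_L2_scale_right exp_i_cnj)

text \<open>Conjugate linearity puts \<open>exp (- \<i> * of_real \<alpha>)\<close> before the
  \<open>v2\<close> term, and the outer factor \<open>e\<close> cancels it. The jump is thereby
  separated from the inner products.\<close>

lemma domA_iff:
  fixes \<alpha> :: real
  assumes "v1 \<in> L2" "v2 \<in> L2"
  defines "e \<equiv> exp (\<i> * of_real \<alpha>)"
  shows "\<psi> \<in> domA v1 v2 \<alpha> \<longleftrightarrow> \<psi> \<in> W21_Omega \<and>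
    lim_plus0 \<psi> - e * lim_minus0 \<psi> = \<i> * e * inner_L2 \<psi> (\<lambda>x. v1 x + e * v2 x)"
proof (cases "\<psi> \<in> W21_Omega")
  case True
  have e: "e * exp (- \<i> * of_real \<alpha>) = 1" unfolding e_def by (rule exp_i_inverse)
  have "\<i> * e * inner_L2 \<psi> (\<lambda>x. v1 x + e * v2 x) =
      \<i> * e * inner_L2 \<psi> v1 + \<i> * (e * exp (- \<i> * of_real \<alpha>)) * inner_L2 \<psi> v2"
    unfolding e_def inner_L2_combination[OF W21_Omega_L2[OF True] assms(1,2)]
    by (simp add: algebra_simps)
  then show ?thesis
    unfolding domA_def e using True by (auto simp: algebra_simps simp flip: e_def)
qed (simp add: domA_def)

section \<open>When two domains coincide\<close>

lemma L2_combination: "v1 \<in> L2 \<Longrightarrow> v2 \<in> L2 \<Longrightarrow> (\<lambda>x. v1 x + c * v2 x) \<in> L2"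
  by (intro L2_add L2_scale)

text \<open>A multiple of a thin spike repairs the boundary condition for the trapezoid. The
  repaired function is orthogonal to \<open>u\<close>, and the correction contributes nothing in the
  limit.\<close>

lemma inner_trapezoid_eq_zero:
  assumes v: "v \<in> L2" and u: "u \<in> L2" and m: "1 \<le> m" "a < b"
    and orth: "\<And>\<psi>. \<psi> \<in> W21_Omega \<Longrightarrow> lim_plus0 \<psi> - e * lim_minus0 \<psi> = \<i> * e * inner_L2 \<psi> v
      \<Longrightarrow> inner_L2 \<psi> u = 0"
  shows "inner_L2 (trapezoid m a b) u = 0"
proof -
  let ?t = "trapezoid m a b" and ?s = "\<lambda>n. spike (real (Suc n))"
  have t: "?t \<in> L2" and s: "?s n \<in> L2" for n
    using m by (auto intro: trapezoid_L2 spike_L2)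
  \<comment> \<open>\<open>N\<close> and \<open>d n\<close> are the defects of the trapezoid and of
    the spike in the boundary condition. By linearity, subtracting \<open>N / d n\<close> times the
    spike makes the defect vanish.\<close>
  define N where "N = ?t 0 * (1 - e) - \<i> * e * inner_L2 ?t v"
  define d where "d = (\<lambda>n. 1 - \<i> * e * inner_L2 (?s n) v)"
  have "d \<longlonglongrightarrow> 1 - \<i> * e * 0"
    unfolding d_def by (intro tendsto_intros inner_spike_tendsto v)
  then have d: "d \<longlonglongrightarrow> 1" by simp
  then have "\<forall>\<^sub>F n in sequentially. d n \<noteq> 0"
    by (rule tendsto_imp_eventually_ne) simp
  then have "\<forall>\<^sub>F n in sequentially. N / d n * inner_L2 (?s n) u = inner_L2 ?t u"
  proof eventually_elim
    case (elim n)
    define c where "c = N / d n"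
    let ?\<psi> = "\<lambda>x. ?t x - c * ?s n x"
    have inner: "inner_L2 ?\<psi> w = inner_L2 ?t w - c * inner_L2 (?s n) w" if "w \<in> L2" for w
      using t s that by (simp add: inner_L2_diff_left L2_scale inner_L2_scale_left)
    have "inner_L2 ?\<psi> u = 0"
    proof (rule orth)
      show "?\<psi> \<in> W21_Omega" using m by (intro jump_test_function_W21) auto
      have "c * d n = N" using elim by (simp add: c_def)
      then show "lim_plus0 ?\<psi> - e * lim_minus0 ?\<psi> = \<i> * e * inner_L2 ?\<psi> v"
        by (simp add: lim_plus0_jump_test_function lim_minus0_jump_test_function inner v N_def d_def
            algebra_simps del: of_nat_Suc)
    qed
    then show ?case using inner[OF u] by (simp add: c_def)
  qed
  \<comment> \<open>The coefficients converge to \<open>N\<close> while the inner products of the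
    spikes with \<open>u\<close> tend to 0.\<close>
  moreover have "(\<lambda>n. N / d n * inner_L2 (?s n) u) \<longlonglongrightarrow> N / 1 * 0"
    using d by (intro tendsto_intros inner_spike_tendsto u) auto
  ultimately have "(\<lambda>n. inner_L2 ?t u) \<longlonglongrightarrow> 0"
    by (simp add: tendsto_cong)
  then show ?thesis by (simp add: LIMSEQ_const_iff)
qed

lemma domA_eq_imp_AE_eq:
  fixes \<alpha> :: real
  assumes "v1 \<in> L2" "v2 \<in> L2" "w1 \<in> L2" "w2 \<in> L2"
    and eq: "domA v1 v2 \<alpha> = domA w1 w2 \<alpha>"
  defines "e \<equiv> exp (\<i> * of_real \<alpha>)"
  shows "AE x in lborel. v1 x + e * v2 x = w1 x + e * w2 x"
proof -
  let ?v = "\<lambda>x. v1 x + e * v2 x" and ?w = "\<lambda>x. w1 x + e * w2 x"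
  define u where "u = (\<lambda>x. ?v x - ?w x)"
  have v: "?v \<in> L2" and w: "?w \<in> L2" using assms by (auto intro: L2_combination)
  have u: "u \<in> L2" unfolding u_def using v w by (rule L2_diff)
  have e: "e \<noteq> 0" by (simp add: e_def)
  have orth: "inner_L2 \<psi> u = 0"
    if "\<psi> \<in> W21_Omega" "lim_plus0 \<psi> - e * lim_minus0 \<psi> = \<i> * e * inner_L2 \<psi> ?v" for \<psi>
  proof -
    have "\<psi> \<in> domA v1 v2 \<alpha>" using that domA_iff[OF assms(1,2)] by (simp add: e_def)
    then have "\<psi> \<in> domA w1 w2 \<alpha>" using eq by simp
    \<comment> \<open>Both boundary conditions prescribe the same jump of \<open>\<psi>\<close>, so
      their right-hand sides agree.\<close>
    then have "\<i> * e * inner_L2 \<psi> ?v = \<i> * e * inner_L2 \<psi> ?w"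
      using that domA_iff[OF assms(3,4)] by (simp add: e_def)
    then show ?thesis
      using e v w that unfolding u_def by (simp add: inner_L2_diff_right W21_Omega_L2)
  qed
  \<comment> \<open>The conjugate appears because \<open>u\<close> sits in the second argument of
    the inner product.\<close>
  have "AE x in lborel. cnj (u x) = 0"
  proof (rule AE_zero_if_interval_integrals_zero)
    fix a b :: real
    have "(\<lambda>x. complex_of_real (indicator {a<..b} x)) \<in> L2"
      by (rule L2_compact_support[of _ 1 a b]) (auto simp: indicator_def)
    from L2_mult_integrable[OF this u] show "set_integrable lborel {a<..b} (\<lambda>x. cnj (u x))"
      by (simp add: set_integrable_def scaleR_conv_of_real)
    assume "a < b"
    then have "inner_L2 (trapezoid (real (Suc n)) a b) u = 0" for n
      using v u orth by (intro inner_trapezoid_eq_zero[of ?v u _ a b e]) auto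
    then show "(LINT x:{a<..b}|lborel. cnj (u x)) = 0"
      using inner_trapezoid_tendsto[OF u \<open>a < b\<close>] by (simp add: LIMSEQ_const_iff)
  qed
  then show ?thesis by (simp add: u_def del: complex_cnj_diff complex_cnj_add)
qed

lemma domA_cong_AE:
  assumes "v1 \<in> L2" "v2 \<in> L2" "w1 \<in> L2" "w2 \<in> L2"
    and eq: "AE x in lborel. v1 x + exp (\<i> * of_real \<alpha>) * v2 x = w1 x + exp (\<i> * of_real \<alpha>) * w2 x"
  shows "domA v1 v2 \<alpha> = domA w1 w2 \<alpha>"
proof (rule set_eqI)
  fix \<psi>
  show "\<psi> \<in> domA v1 v2 \<alpha> \<longleftrightarrow> \<psi> \<in> domA w1 w2 \<alpha>"
  proof (cases "\<psi> \<in> W21_Omega")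
    case True
    have "inner_L2 \<psi> (\<lambda>x. v1 x + exp (\<i> * of_real \<alpha>) * v2 x)
        = inner_L2 \<psi> (\<lambda>x. w1 x + exp (\<i> * of_real \<alpha>) * w2 x)"
      using W21_Omega_L2[OF True] assms by (intro inner_L2_cong_AE L2_combination)
    then show ?thesis using domA_iff[OF assms(1,2)] domA_iff[OF assms(3,4)] by simp
  qed (simp add: domA_def)
qed

section \<open>The differences of the operators\<close>

text \<open>The derivative term is common to both operators, so the identity holds at every
  \<open>x\<close>. Substituting the boundary condition for \<open>lim_plus0 \<psi>\<close> cancels
  all terms with \<open>lim_minus0 \<psi>\<close>, and \<open>e * e' = 1\<close> cancels the product
  of \<open>v2\<close> with \<open>\<langle>\<psi>, v2\<rangle>\<close>.\<close>

lemma opA_diff: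
  fixes \<alpha> :: real
  assumes "v1 \<in> L2" "v2 \<in> L2" "\<psi> \<in> domA v1 v2 \<alpha>"
  defines "e \<equiv> exp (\<i> * of_real \<alpha>)" and "e' \<equiv> exp (- \<i> * of_real \<alpha>)"
  shows "opA v1 v2 \<alpha> \<psi> x - opA (\<lambda>x. v1 x + e * v2 x) (\<lambda>_. 0) \<alpha> \<psi> x
    = (\<i> / 2) * e * v2 x * inner_L2 \<psi> v1 - (\<i> / 2) * e' * v1 x * inner_L2 \<psi> v2"
proof -
  have \<psi>: "\<psi> \<in> L2" using assms(3) by (auto simp: domA_def W21_Omega_L2)
  have ee: "e * e' = 1" unfolding e_def e'_def by (rule exp_i_inverse)
  have inner: "inner_L2 \<psi> (\<lambda>x. v1 x + e * v2 x) = inner_L2 \<psi> v1 + e' * inner_L2 \<psi> v2"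
    unfolding e_def e'_def using \<psi> assms by (intro inner_L2_combination)
  have lim: "lim_plus0 \<psi> = \<i> * inner_L2 \<psi> v2 + e * (lim_minus0 \<psi> + \<i> * inner_L2 \<psi> v1)"
    using assms(3) by (simp add: domA_def e_def algebra_simps)
  have "e * (e' * z) = z" for z by (simp add: ee flip: mult.assoc)
  then show ?thesis
    unfolding opA_def inner lim by (simp add: field_simps)
qed

text \<open>The inner products agree exactly; only the pointwise factors \<open>v x\<close> and
  \<open>w x\<close> restrict the equality to almost every \<open>x\<close>.\<close>

lemma opA_cong_AE:
  assumes "v \<in> L2" "w \<in> L2" "\<psi> \<in> L2" "AE x in lborel. v x = w x"
  shows "AE x in lborel. opA v (\<lambda>_. 0) \<alpha> \<psi> x = opA w (\<lambda>_. 0) \<alpha> \<psi> x"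
  using assms(4) unfolding opA_def inner_L2_cong_AE[OF assms] by eventually_elim simp

theorem theorem3p1:
  fixes v1 v2 w1 w2 :: "real \<Rightarrow> complex" and \<alpha> :: real
  assumes "v1 \<in> L2" "v2 \<in> L2" "w1 \<in> L2" "w2 \<in> L2"
  defines "v \<equiv> (\<lambda>x. v1 x + exp (\<i> * of_real \<alpha>) * v2 x)"
  shows
    "(domA v1 v2 \<alpha> = domA w1 w2 \<alpha> \<longleftrightarrow>
       (AE x in lborel. v1 x + exp (\<i> * of_real \<alpha>) * v2 x = w1 x + exp (\<i> * of_real \<alpha>) * w2 x))
   \<and> domA v1 v2 \<alpha> = domA v (\<lambda>_. 0) \<alpha>
   \<and> (\<forall>\<psi>\<in>domA v1 v2 \<alpha>. AE x in lborel.
        opA v1 v2 \<alpha> \<psi> x - opA v (\<lambda>_. 0) \<alpha> \<psi> x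
        = (\<i> / 2) * exp (\<i> * of_real \<alpha>) * v2 x * inner_L2 \<psi> v1
          - (\<i> / 2) * exp (- \<i> * of_real \<alpha>) * v1 x * inner_L2 \<psi> v2)
   \<and> bounded_symmetric_L2 (\<lambda>\<psi> x. (\<i> / 2) * exp (\<i> * of_real \<alpha>) * v2 x * inner_L2 \<psi> v1
          - (\<i> / 2) * exp (- \<i> * of_real \<alpha>) * v1 x * inner_L2 \<psi> v2)
   \<and> ((AE x in lborel. v1 x + exp (\<i> * of_real \<alpha>) * v2 x = w1 x + exp (\<i> * of_real \<alpha>) * w2 x) \<longrightarrow>
       (\<exists>f g :: nat \<Rightarrow> real \<Rightarrow> complex.
          (\<forall>k<4. f k \<in> L2 \<and> g k \<in> L2) \<and>
          (\<forall>\<psi>\<in>domA v1 v2 \<alpha>. AE x in lborel.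
             opA v1 v2 \<alpha> \<psi> x - opA w1 w2 \<alpha> \<psi> x = (\<Sum>k<4. f k x * inner_L2 \<psi> (g k))) \<and>
          bounded_symmetric_L2 (\<lambda>\<psi> x. \<Sum>k<4. f k x * inner_L2 \<psi> (g k))))"
proof -
  define e where "e = exp (\<i> * of_real \<alpha>)"
  define e' where "e' = exp (- \<i> * of_real \<alpha>)"
  have cnj: "cnj e = e'" "cnj e' = e"
    using exp_i_cnj[of \<alpha>] exp_i_cnj[of "- \<alpha>"] by (simp_all add: e_def e'_def)
  \<comment> \<open>Terms 0 and 1 give the difference for \<open>v1, v2\<close> from
    \<open>opA_diff\<close>; terms 2 and 3 give the one for \<open>w1, w2\<close> with opposite
    sign.\<close>
  define f where "f = (\<lambda>k::nat. [\<lambda>x. (\<i> / 2) * e * v2 x, \<lambda>x. - (\<i> / 2) * e' * v1 x,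
    \<lambda>x. - (\<i> / 2) * e * w2 x, \<lambda>x. (\<i> / 2) * e' * w1 x] ! k)"
  define g where "g = (\<lambda>k::nat. [v1, v2, w1, w2] ! k)"
  have less4: "k = 0 \<or> k = 1 \<or> k = 2 \<or> k = 3" if "k < 4" for k :: nat
    using that by auto
  have f: "f k \<in> L2" and g: "g k \<in> L2" if "k < 4" for k
    using less4[OF that] assms(1-4) L2_scale[of v2 "(\<i> / 2) * e"] L2_scale[of v1 "- (\<i> / 2) * e'"]
      L2_scale[of w2 "- (\<i> / 2) * e"] L2_scale[of w1 "(\<i> / 2) * e'"]
    by (auto simp: f_def g_def)
  have sum2: "(\<Sum>k<2. h k) = h 0 + h (Suc 0)"
    and sum4: "(\<Sum>k<4. h k) = h 0 + h (Suc 0) + h 2 + h 3" for h :: "nat \<Rightarrow> complex"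
    by (simp_all add: numeral_eq_Suc)
  \<comment> \<open>Since \<open>cnj ((\<i> / 2) * e) = - (\<i> / 2) * e'\<close>, the adjoint of
    term 0 is term 1 and that of term 2 is term 3. This yields the symmetry of both
    operators.\<close>
  have inner_f: "inner_L2 (f 0) \<phi> = (\<i> / 2) * e * inner_L2 v2 \<phi>"
      "inner_L2 (f (Suc 0)) \<phi> = - (\<i> / 2) * e' * inner_L2 v1 \<phi>"
      "inner_L2 (f 2) \<phi> = - (\<i> / 2) * e * inner_L2 w2 \<phi>"
      "inner_L2 (f 3) \<phi> = (\<i> / 2) * e' * inner_L2 w1 \<phi>"
      "inner_L2 \<phi> (f 0) = - (\<i> / 2) * e' * inner_L2 \<phi> v2"
      "inner_L2 \<phi> (f (Suc 0)) = (\<i> / 2) * e * inner_L2 \<phi> v1"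
      "inner_L2 \<phi> (f 2) = (\<i> / 2) * e' * inner_L2 \<phi> w2"
      "inner_L2 \<phi> (f 3) = - (\<i> / 2) * e * inner_L2 \<phi> w1" for \<phi>
    unfolding f_def by (simp_all only: nth_Cons_0 nth_Cons_Suc numeral_2_eq_2 numeral_3_eq_3
        inner_L2_scale_left inner_L2_scale_right) (simp_all add: cnj)
  have g_simps: "g 0 = v1" "g (Suc 0) = v2" "g 2 = w1" "g 3 = w2"
    by (simp_all add: g_def numeral_2_eq_2 numeral_3_eq_3)
  have f_simps: "f 0 x = (\<i> / 2) * e * v2 x" "f (Suc 0) x = - (\<i> / 2) * e' * v1 x"
      "f 2 x = - (\<i> / 2) * e * w2 x" "f 3 x = (\<i> / 2) * e' * w1 x" for x
    by (simp_all add: f_def numeral_2_eq_2 numeral_3_eq_3)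
  have v: "v \<in> L2" unfolding v_def using assms by (intro L2_combination)
  let ?eq = "AE x in lborel. v1 x + e * v2 x = w1 x + e * w2 x"
  have "domA v1 v2 \<alpha> = domA w1 w2 \<alpha> \<longleftrightarrow> ?eq"
    unfolding e_def using domA_eq_imp_AE_eq[OF assms(1-4)] domA_cong_AE[OF assms(1-4)] by blast
  moreover have "domA v1 v2 \<alpha> = domA v (\<lambda>_. 0) \<alpha>"
    by (rule domA_cong_AE[OF assms(1,2) v L2_zero]) (simp add: v_def)
  moreover have "\<forall>\<psi>\<in>domA v1 v2 \<alpha>. AE x in lborel. opA v1 v2 \<alpha> \<psi> x - opA v (\<lambda>_. 0) \<alpha> \<psi> x
      = (\<i> / 2) * e * v2 x * inner_L2 \<psi> v1 - (\<i> / 2) * e' * v1 x * inner_L2 \<psi> v2"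
    unfolding v_def e_def e'_def using opA_diff[OF assms(1,2)] by simp
  moreover have "bounded_symmetric_L2 (\<lambda>\<psi> x. (\<i> / 2) * e * v2 x * inner_L2 \<psi> v1
      - (\<i> / 2) * e' * v1 x * inner_L2 \<psi> v2)"
  proof -
    have "bounded_symmetric_L2 (\<lambda>\<psi> x. \<Sum>k<2. f k x * inner_L2 \<psi> (g k))"
      using f g by (intro bounded_symmetric_finite_rank) (auto simp: sum2 inner_f g_simps algebra_simps)
    then show ?thesis by (simp add: sum2 f_simps g_simps)
  qed
  moreover have "?eq \<longrightarrow> (\<exists>f g :: nat \<Rightarrow> real \<Rightarrow> complex.
      (\<forall>k<4. f k \<in> L2 \<and> g k \<in> L2) \<and>
      (\<forall>\<psi>\<in>domA v1 v2 \<alpha>. AE x in lborel.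
         opA v1 v2 \<alpha> \<psi> x - opA w1 w2 \<alpha> \<psi> x = (\<Sum>k<4. f k x * inner_L2 \<psi> (g k))) \<and>
      bounded_symmetric_L2 (\<lambda>\<psi> x. \<Sum>k<4. f k x * inner_L2 \<psi> (g k)))"
  proof (intro impI exI conjI ballI)
    assume eq: ?eq
    show "\<forall>k<4. f k \<in> L2 \<and> g k \<in> L2" using f g by blast
    show "bounded_symmetric_L2 (\<lambda>\<psi> x. \<Sum>k<4. f k x * inner_L2 \<psi> (g k))"
      using f g by (intro bounded_symmetric_finite_rank) (auto simp: sum4 inner_f g_simps algebra_simps)
    fix \<psi> assume \<psi>: "\<psi> \<in> domA v1 v2 \<alpha>"
    then have \<psi>': "\<psi> \<in> domA w1 w2 \<alpha>"
      using eq domA_cong_AE[OF assms(1-4)] by (simp add: e_def)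
    have "\<psi> \<in> L2" using \<psi> by (auto simp: domA_def W21_Omega_L2)
    then have "AE x in lborel. opA (\<lambda>x. v1 x + e * v2 x) (\<lambda>_. 0) \<alpha> \<psi> x
        = opA (\<lambda>x. w1 x + e * w2 x) (\<lambda>_. 0) \<alpha> \<psi> x"
      using assms eq by (intro opA_cong_AE L2_combination)
    then show "AE x in lborel. opA v1 v2 \<alpha> \<psi> x - opA w1 w2 \<alpha> \<psi> x
        = (\<Sum>k<4. f k x * inner_L2 \<psi> (g k))"
    proof eventually_elim
      case (elim x)
      \<comment> \<open>The two one-function operators agree at this \<open>x\<close>, so they can
        be inserted with opposite signs; \<open>\<psi>\<close> lies in both domains, so
        \<open>opA_diff\<close> applies to each bracket.\<close>
      then have "opA v1 v2 \<alpha> \<psi> x - opA w1 w2 \<alpha> \<psi> x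
          = (opA v1 v2 \<alpha> \<psi> x - opA (\<lambda>x. v1 x + e * v2 x) (\<lambda>_. 0) \<alpha> \<psi> x)
          - (opA w1 w2 \<alpha> \<psi> x - opA (\<lambda>x. w1 x + e * w2 x) (\<lambda>_. 0) \<alpha> \<psi> x)"
        by simp
      also have "\<dots> = (\<Sum>k<4. f k x * inner_L2 \<psi> (g k))"
        unfolding sum4 f_simps g_simps e_def e'_def
          opA_diff[OF assms(1,2) \<psi>] opA_diff[OF assms(3,4) \<psi>']
        by simp
      finally show ?case .
    qed
  qed
  ultimately show ?thesis unfolding e_def e'_def by blast
qed

end
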